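(* Let $f(\cdot;i):\mathbb{R}^d\to\mathbb{R}$, $i\in[n]$, and $F(w)=\frac1n\sum_{i=1}^n f(w;i)$. Assume: (a) $\mathrm{dom}(F)\neq\emptyset$ and $F_*:=\inf_{w\in\mathbb{R}^d}F(w)>-\infty$; (b) there is $L>0$ such that for every $i\in[n]$ and all $w,w'\in\mathrm{dom}(F)$, $\|\nabla f(w;i)-\nabla f(w';i)\|\le L\|w-w'\|$; (c) there is $G>0$ such that $\|\nabla f(w;i)\|\le G$ for all $w\in\mathrm{dom}(F)$ and $i\in[n]$. Fix $T\ge1$ and run the Single Shuffling Momentum Gradient algorithm (described in the context) with: $\beta:=\left(\frac{\nu}{T^{2/3}}\right)^{1/n}$ for some constant $\nu\ge0$ such that $\beta\le\left(\frac{R-1}{R}\right)^{1/n}$ for some $R\ge1$; and $\eta_t:=\frac{\gamma}{T^{1/3}}$ for some $\gamma>0$ such that $\frac{\gamma}{T^{1/3}}\le\frac1L$. Then $$\mathbb{E}\big[\|\nabla F(\hat w_T)\|^2\big]\le\frac{D_0}{T^{2/3}}+\frac{R\|\nabla F(\tilde w_0)\|^2}{T}+\frac{2LG^2R\gamma}{T^{4/3}},$$ where $$D_0:=\frac{2R}{\gamma}[F(\tilde w_0)-F_*]+\frac{R}{\gamma L}\|\nabla F(\tilde w_0)\|^2+L^2G^2\gamma^2+4\nu G^2R.$$ Thus the convergence rate of the algorithm is $\mathcal{O}(T^{-2/3})$.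
   Context: $[n]=\{1,\dots,n\}$; $\|\cdot\|$ is the Euclidean norm; $\mathbb{E}$ is expectation over all randomness (of the permutation, if random, and of the output). Since each $f(\cdot;i)$ is real-valued on $\mathbb{R}^d$, $\mathrm{dom}(F)=\mathbb{R}^d$; each $f(\cdot;i)$ is differentiable. Single Shuffling Momentum Gradient algorithm, with parameters $\beta$, number of epochs $T\ge1$, and $\eta_t$: Choose $\tilde w_0\in\mathbb{R}^d$ (deterministic) and set $\tilde m_0:=0$. Generate one permutation $\pi$ of $[n]$ (arbitrary), used at every epoch. For $t=1,\dots,T$: set $w_0^{(t)}:=\tilde w_{t-1}$, $m_0^{(t)}:=\tilde m_{t-1}$; for $i=0,\dots,n-1$ put $g_i^{(t)}:=\nabla f(w_i^{(t)};\pi(i+1))$ and $$m_{i+1}^{(t)}:=\beta m_i^{(t)}+(1-\beta)g_i^{(t)},\qquad w_{i+1}^{(t)}:=w_i^{(t)}-\tfrac{\eta_t}{n}m_{i+1}^{(t)};$$ then set $\tilde w_t:=w_n^{(t)}$ and $\tilde m_t:=m_n^{(t)}$. Output: $\hat w_T\in\{\tilde w_0,\dots,\tilde w_{T-1}\}$ chosen at random (independently of $\pi$) with probability $\mathbb{P}[\hat w_T=\tilde w_{t-1}]=\eta_t/\sum_{s=1}^T\eta_s$. *)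

theory Defs
  imports "HOL-Probability.Probability" "HOL-Library.Landau_Symbols"
begin

definition grad :: "('a::real_inner \<Rightarrow> real) \<Rightarrow> 'a \<Rightarrow> 'a" where
  "grad h w = (THE g. GDERIV h w :> g)"

lemma grad_eqI:
  assumes "GDERIV h w :> g"
  shows "grad h w = g"
  unfolding grad_def
proof (rule the_equality)
  show "GDERIV h w :> g" by (fact assms)
next
  fix g' assume "GDERIV h w :> g'"
  with assms have "(\<lambda>v. v \<bullet> g) = (\<lambda>v. v \<bullet> g')"
    unfolding gderiv_def by (rule has_derivative_unique)
  then have "v \<bullet> (g' - g) = 0" for v
    by (metis inner_diff_right diff_self)
  then show "g' = g"
    by (metis inner_eq_zero_iff right_minus_eq)
qed

lemma GDERIV_grad:
  fixes h :: "'a::euclidean_space \<Rightarrow> real"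
  assumes "h differentiable at w"
  shows "GDERIV h w :> grad h w"
proof -
  obtain D where D: "(h has_derivative D) (at w)"
    using assms unfolding differentiable_def by blast
  interpret linear D using D by (rule has_derivative_linear)
  define g where "g = (\<Sum>b\<in>Basis. D b *\<^sub>R b)"
  have "D v = v \<bullet> g" for v
  proof -
    have "D v = D (\<Sum>b\<in>Basis. (v \<bullet> b) *\<^sub>R b)" by (simp add: euclidean_representation)
    also have "\<dots> = v \<bullet> g" by (simp add: sum scale g_def inner_sum_right mult.commute)
    finally show ?thesis .
  qed
  then have "D = (\<lambda>v. v \<bullet> g)" by auto
  with D have "GDERIV h w :> g" unfolding gderiv_def by simp
  then show ?thesis using grad_eqI by metis
qed

text \<open>
  Pairs below are \<open>(w, m)\<close>: the iterate together with the momentum. \<open>smg_inner f n \<beta> \<eta> \<pi> s i\<close> is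
  the pair after \<open>i\<close> inner steps of one epoch with learning rate \<open>\<eta>\<close> that starts from \<open>s\<close>;
  component indices and the permutation \<open>\<pi>\<close> live on \<open>{1..n}\<close>.
\<close>

primrec smg_inner ::
  "(nat \<Rightarrow> 'a::euclidean_space \<Rightarrow> real) \<Rightarrow> nat \<Rightarrow> real \<Rightarrow> real \<Rightarrow> (nat \<Rightarrow> nat) \<Rightarrow> 'a \<times> 'a \<Rightarrow> nat \<Rightarrow> 'a \<times> 'a"
where
  "smg_inner f n \<beta> \<eta> \<pi> s 0 = s"
| "smg_inner f n \<beta> \<eta> \<pi> s (Suc i) =
    (let (w, m) = smg_inner f n \<beta> \<eta> \<pi> s i;
         g = grad (f (\<pi> (i + 1))) w;
         m' = \<beta> *\<^sub>R m + (1 - \<beta>) *\<^sub>R g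
     in (w - (\<eta> / real n) *\<^sub>R m', m'))"

primrec smg_epoch ::
  "(nat \<Rightarrow> 'a::euclidean_space \<Rightarrow> real) \<Rightarrow> nat \<Rightarrow> real \<Rightarrow> (nat \<Rightarrow> real) \<Rightarrow> 'a \<Rightarrow> (nat \<Rightarrow> nat) \<Rightarrow> nat \<Rightarrow> 'a \<times> 'a"
where
  "smg_epoch f n \<beta> \<eta> w0 \<pi> 0 = (w0, 0)"
| "smg_epoch f n \<beta> \<eta> w0 \<pi> (Suc t) =
    smg_inner f n \<beta> (\<eta> (Suc t)) \<pi> (smg_epoch f n \<beta> \<eta> w0 \<pi> t) n"

definition smg_iterate ::
  "(nat \<Rightarrow> 'a::euclidean_space \<Rightarrow> real) \<Rightarrow> nat \<Rightarrow> real \<Rightarrow> (nat \<Rightarrow> real) \<Rightarrow> 'a \<Rightarrow> (nat \<Rightarrow> nat) \<Rightarrow> nat \<Rightarrow> 'a"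
where
  "smg_iterate f n \<beta> \<eta> w0 \<pi> t = fst (smg_epoch f n \<beta> \<eta> w0 \<pi> t)"

definition smg_index_pmf :: "nat \<Rightarrow> (nat \<Rightarrow> real) \<Rightarrow> nat pmf" where
  "smg_index_pmf T \<eta> = embed_pmf (\<lambda>t. if t \<in> {1..T} then \<eta> t / (\<Sum>s = 1..T. \<eta> s) else 0)"

lemma pmf_smg_index_pmf:
  assumes "T \<ge> 1" and pos: "\<And>t. t \<in> {1..T} \<Longrightarrow> \<eta> t > 0"
  shows "pmf (smg_index_pmf T \<eta>) t = (if t \<in> {1..T} then \<eta> t / (\<Sum>s = 1..T. \<eta> s) else 0)"
proof -
  let ?S = "\<Sum>s = 1..T. \<eta> s"
  let ?p = "\<lambda>t. if t \<in> {1..T} then \<eta> t / ?S else 0"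
  have S: "?S > 0" using assms by (intro sum_pos) auto
  have nn: "0 \<le> ?p t" for t using S pos[of t] by (auto intro: less_imp_le)
  have "(\<integral>\<^sup>+ t. ennreal (?p t) \<partial>count_space UNIV) = (\<Sum>t\<in>{1..T}. ennreal (?p t))"
    by (rule nn_integral_count_space') auto
  also have "\<dots> = ennreal (\<Sum>t\<in>{1..T}. ?p t)" by (rule sum_ennreal) (rule nn)
  also have "(\<Sum>t\<in>{1..T}. ?p t) = 1" using S by (simp add: sum_divide_distrib[symmetric])
  finally have "(\<integral>\<^sup>+ t. ennreal (?p t) \<partial>count_space UNIV) = 1" by simp
  with nn show ?thesis unfolding smg_index_pmf_def by (rule pmf_embed_pmf)
qed

text \<open>
  The law of the output: one permutation is drawn from \<open>P\<close> (a point mass if it is deterministic) and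
  used in every epoch, and the output index is drawn independently of it.
\<close>

definition smg_output ::
  "(nat \<Rightarrow> 'a::euclidean_space \<Rightarrow> real) \<Rightarrow> nat \<Rightarrow> real \<Rightarrow> (nat \<Rightarrow> real) \<Rightarrow> nat \<Rightarrow> 'a \<Rightarrow> (nat \<Rightarrow> nat) pmf \<Rightarrow> 'a pmf"
where
  "smg_output f n \<beta> \<eta> T w0 P =
    map_pmf (\<lambda>(\<pi>, t). smg_iterate f n \<beta> \<eta> w0 \<pi> (t - 1)) (pair_pmf P (smg_index_pmf T \<eta>))"

end

theory Submission
  imports Defs
begin

text \<open>
  The bound holds for every fixed permutation; averaging over the permutation and the (uniform) output
  index is then immediate. Fix the permutation and write \<open>c\<^sub>t\<close> for the point where epoch \<open>t\<close> starts,
  \<open>M\<^sub>t\<close> for the average momentum in it, \<open>\<eta>\<close> for the step size and \<open>b = \<beta> ^ n\<close>. One epoch is the step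
  \<open>c\<^sub>t - \<eta> M\<^sub>t\<close>, so the descent inequality for the \<open>L\<close>-smooth function \<open>F\<close> and \<open>\<eta> L \<le> 1\<close> bound the
  squared gradient norm at \<open>c\<^sub>t\<close> by \<open>2 / \<eta>\<close> times the decrease of \<open>F\<close>, plus the squared norm of
  \<open>\<nabla>F(c\<^sub>t) - M\<^sub>t\<close> (\<open>epoch_descent\<close>).

  Since the same permutation is used in every epoch, any \<open>n\<close> consecutive steps use each component
  once. Unrolling the momentum over exactly \<open>n\<close> steps and summing over an epoch therefore gives
  \<open>M\<^sub>t = b M\<^sub>t\<^sub>-\<^sub>1 + (1 - b) \<nabla>F(c\<^sub>t)\<close> up to an error that only comes from evaluating gradients at points
  within \<open>\<eta> G\<close> of \<open>c\<^sub>t\<close>, hence of norm at most \<open>(1 - b) L \<eta> G\<close> (\<open>momentum_period_sum\<close>,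
  \<open>norm_momentum_error_le\<close>). By convexity of the square, the squared norm of \<open>\<nabla>F(c\<^sub>t) - M\<^sub>t\<close> is at
  most \<open>4 b G\<^sup>2 + L\<^sup>2 \<eta>\<^sup>2 G\<^sup>2\<close> (\<open>later_epoch\<close>). The first epoch has no predecessor and is treated
  separately: it increases \<open>F\<close> by a controlled amount only (\<open>first_epoch\<close>). Summing over the epochs and
  inserting \<open>\<eta> = \<gamma> / T\<^sup>1\<^sup>/\<^sup>3\<close> and \<open>b = \<nu> / T\<^sup>2\<^sup>/\<^sup>3\<close> gives the claim.
\<close>

section \<open>The descent inequality\<close>

lemma descent_lemma:
  fixes h :: "'a::real_inner \<Rightarrow> real"
  assumes deriv: "\<And>x. GDERIV h x :> h' x"
    and lip: "\<And>x y. norm (h' x - h' y) \<le> L * norm (x - y)"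
  shows "h y \<le> h x + h' x \<bullet> (y - x) + L / 2 * (norm (y - x))\<^sup>2"
proof -
  define d where "d = y - x"
  define \<phi> where "\<phi> s = h (x + s *\<^sub>R d) - s * (h' x \<bullet> d) - L / 2 * s\<^sup>2 * (norm d)\<^sup>2" for s :: real
  have "\<phi> 1 \<le> \<phi> 0"
  proof (rule DERIV_nonpos_imp_nonincreasing[of 0 1 \<phi>])
    fix s :: real
    assume s: "0 \<le> s" "s \<le> 1"
    have "(h has_derivative (\<lambda>v. v \<bullet> h' (x + s *\<^sub>R d))) (at (x + s *\<^sub>R d))"
      using deriv by (simp add: gderiv_def)
    then have "((\<lambda>s. h (x + s *\<^sub>R d)) has_derivative (\<lambda>r. (r *\<^sub>R d) \<bullet> h' (x + s *\<^sub>R d))) (at s)"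
      by (rule has_derivative_compose[rotated]) (auto intro!: derivative_eq_intros)
    then have "((\<lambda>s. h (x + s *\<^sub>R d)) has_real_derivative (h' (x + s *\<^sub>R d) \<bullet> d)) (at s)"
      by (simp add: has_field_derivative_def inner_commute mult.commute[of _ "_ \<bullet> _"])
    then have "(\<phi> has_real_derivative
        (h' (x + s *\<^sub>R d) \<bullet> d - h' x \<bullet> d - L * s * (norm d)\<^sup>2)) (at s)"
      unfolding \<phi>_def by (auto intro!: derivative_eq_intros)
    moreover have "(h' (x + s *\<^sub>R d) - h' x) \<bullet> d \<le> norm (h' (x + s *\<^sub>R d) - h' x) * norm d"
      by (rule norm_cauchy_schwarz)
    moreover have "norm (h' (x + s *\<^sub>R d) - h' x) * norm d \<le> (L * (s * norm d)) * norm d"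
      using lip[of "x + s *\<^sub>R d" x] s by (intro mult_right_mono) auto
    ultimately show "\<exists>D. (\<phi> has_real_derivative D) (at s) \<and> D \<le> 0"
      by (intro exI conjI) (auto simp: inner_diff_left power2_eq_square algebra_simps)
  qed simp
  then show ?thesis by (simp add: \<phi>_def d_def)
qed

section \<open>Momentum driven by an almost periodic sequence\<close>

lemma sum_cyclic_shift:
  fixes h :: "nat \<Rightarrow> 'a::ab_group_add"
  shows "(\<Sum>k<n. h ((k + s) mod n)) = (\<Sum>k<n. h k)"
proof (induction s)
  case 0
  show ?case by (intro sum.cong) auto
next
  case (Suc s)
  let ?q = "\<lambda>k. h ((k + s) mod n)"
  have "(\<Sum>k<n. ?q (Suc k)) + ?q 0 = (\<Sum>k<Suc n. ?q k)"
    by (subst sum.lessThan_Suc_shift) (rule add.commute)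
  also have "\<dots> = (\<Sum>k<n. ?q k) + ?q n"
    by (rule sum.lessThan_Suc)
  finally show ?case using Suc by simp
qed

lemma momentum_unroll:
  fixes m g :: "nat \<Rightarrow> 'a::real_vector"
  assumes "\<And>k. m (Suc k) = \<beta> *\<^sub>R m k + (1 - \<beta>) *\<^sub>R g k"
  shows "m (k + j) = \<beta> ^ j *\<^sub>R m k + (1 - \<beta>) *\<^sub>R (\<Sum>l<j. \<beta> ^ (j - Suc l) *\<^sub>R g (k + l))"
proof (induction j)
  case (Suc j)
  have "(\<Sum>l<j. \<beta> ^ (j - l) *\<^sub>R g (k + l)) = \<beta> *\<^sub>R (\<Sum>l<j. \<beta> ^ (j - Suc l) *\<^sub>R g (k + l))"
    unfolding scaleR_sum_right
    by (intro sum.cong) (auto simp flip: power_Suc simp: Suc_diff_Suc)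
  moreover have "m (k + Suc j) = \<beta> *\<^sub>R (\<beta> ^ j *\<^sub>R m k
      + (1 - \<beta>) *\<^sub>R (\<Sum>l<j. \<beta> ^ (j - Suc l) *\<^sub>R g (k + l))) + (1 - \<beta>) *\<^sub>R g (k + j)"
    using assms[of "k + j"] by (simp only: Suc add_Suc_right)
  ultimately show ?case
    by (simp add: scaleR_add_right mult.commute)
qed simp

text \<open>
  If the inputs over two consecutive periods are within \<open>\<epsilon>\<close> of an \<open>n\<close>-periodic sequence \<open>h\<close>, then
  the total momentum of the second period is, up to \<open>\<epsilon>\<close> per step, the convex combination with
  weight \<open>\<beta> ^ n\<close> of the total momentum of the first period and the total of \<open>h\<close>: each
  \<open>n\<close> consecutive inputs run through all of \<open>h\<close>, so after summing over a period the geometric weights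
  no longer depend on the position.
\<close>

lemma momentum_period_sum:
  fixes m g h :: "nat \<Rightarrow> 'a::real_normed_vector"
  assumes rec: "\<And>k. m (Suc k) = \<beta> *\<^sub>R m k + (1 - \<beta>) *\<^sub>R g k"
    and \<beta>: "0 \<le> \<beta>" "\<beta> \<le> 1"
    and close: "\<And>k. a \<le> k \<Longrightarrow> k < a + 2 * n \<Longrightarrow> norm (g k - h (k mod n)) \<le> \<epsilon>"
  shows "norm ((\<Sum>k<n. m (Suc (a + n + k))) - \<beta> ^ n *\<^sub>R (\<Sum>k<n. m (Suc (a + k)))
            - (1 - \<beta> ^ n) *\<^sub>R (\<Sum>k<n. h k)) \<le> (1 - \<beta> ^ n) * (real n * \<epsilon>)"
proof -
  let ?w = "\<lambda>l. (1 - \<beta>) * \<beta> ^ (n - Suc l)"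
  let ?r = "\<lambda>k l. g (Suc (a + k) + l) - h ((Suc (a + k) + l) mod n)"
  have w: "(\<Sum>l<n. ?w l) = 1 - \<beta> ^ n"
    by (simp add: one_diff_power_eq' sum_distrib_left)
  have w0: "0 \<le> ?w l" for l using \<beta> by simp
  have "(\<Sum>k<n. \<Sum>l<n. ?w l *\<^sub>R h ((Suc (a + k) + l) mod n))
      = (\<Sum>l<n. \<Sum>k<n. ?w l *\<^sub>R h ((Suc (a + k) + l) mod n))"
    by (rule sum.swap)
  also have "\<dots> = (\<Sum>l<n. ?w l *\<^sub>R (\<Sum>k<n. h ((k + (Suc a + l)) mod n)))"
    by (simp add: scaleR_sum_right ac_simps)
  also have "\<dots> = (\<Sum>l<n. ?w l *\<^sub>R (\<Sum>k<n. h k))"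
    by (simp only: sum_cyclic_shift)
  also have "\<dots> = (1 - \<beta> ^ n) *\<^sub>R (\<Sum>k<n. h k)"
    by (simp only: scaleR_sum_left[symmetric] w)
  finally have h: "(\<Sum>k<n. \<Sum>l<n. ?w l *\<^sub>R h ((Suc (a + k) + l) mod n))
      = (1 - \<beta> ^ n) *\<^sub>R (\<Sum>k<n. h k)" .
  have m: "m (Suc (a + n + k)) = \<beta> ^ n *\<^sub>R m (Suc (a + k))
      + (\<Sum>l<n. ?w l *\<^sub>R g (Suc (a + k) + l))" for k
    using momentum_unroll[of m \<beta> g "Suc (a + k)" n, OF rec]
    by (simp add: scaleR_sum_right ac_simps)
  have "(\<Sum>k<n. m (Suc (a + n + k))) - \<beta> ^ n *\<^sub>R (\<Sum>k<n. m (Suc (a + k)))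
      - (1 - \<beta> ^ n) *\<^sub>R (\<Sum>k<n. h k) = (\<Sum>k<n. \<Sum>l<n. ?w l *\<^sub>R ?r k l)"
    unfolding m h[symmetric] sum.distrib scaleR_sum_right[symmetric] scaleR_diff_right sum_subtractf
    by (simp only: add_diff_cancel_left')
  also have "norm \<dots> \<le> (\<Sum>k<n. \<Sum>l<n. ?w l * \<epsilon>)"
  proof (intro sum_norm_le)
    fix k l assume "k \<in> {..<n}" "l \<in> {..<n}"
    then have "norm (?r k l) \<le> \<epsilon>" by (intro close) auto
    then have "?w l * norm (?r k l) \<le> ?w l * \<epsilon>" by (rule mult_left_mono) (rule w0)
    then show "norm (?w l *\<^sub>R ?r k l) \<le> ?w l * \<epsilon>"
      by (simp only: norm_scaleR abs_of_nonneg[OF w0])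
  qed
  also have "\<dots> = (1 - \<beta> ^ n) * (real n * \<epsilon>)"
    by (simp only: sum_distrib_right[symmetric] w) simp
  finally show ?thesis .
qed

section \<open>Cyclic momentum gradient steps\<close>

text \<open>
  The inner steps of all epochs, numbered consecutively: \<open>x k\<close> and \<open>m k\<close> are the iterate and the
  momentum after \<open>k\<close> inner steps with the constant step size \<open>\<eta> / n\<close>, so that epoch \<open>t\<close> starts from
  \<open>x (t * n)\<close>. The \<open>k\<close>-th step uses the component gradient \<open>G' (k mod n)\<close>, and \<open>F'\<close> is the gradient of
  the objective \<open>F\<close>.
\<close>

locale cyclic_momentum =
  fixes G' :: "nat \<Rightarrow> 'a::real_inner \<Rightarrow> 'a" and F :: "'a \<Rightarrow> real" and F' :: "'a \<Rightarrow> 'a"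
    and x m :: "nat \<Rightarrow> 'a" and n :: nat and \<beta> \<eta> L G F_star :: real
  assumes n: "n \<ge> 1"
    and \<beta>: "0 \<le> \<beta>" "\<beta> \<le> 1"
    and L: "L > 0" and \<eta>: "\<eta> > 0" "\<eta> * L \<le> 1" and G: "G > 0"
    and lipschitz: "\<And>i w w'. i < n \<Longrightarrow> norm (G' i w - G' i w') \<le> L * norm (w - w')"
    and bounded: "\<And>i w. i < n \<Longrightarrow> norm (G' i w) \<le> G"
    and F': "\<And>w. F' w = (1 / real n) *\<^sub>R (\<Sum>i<n. G' i w)"
    and GDERIV_F: "\<And>w. GDERIV F w :> F' w"
    and F_star: "\<And>w. F_star \<le> F w"
    and m_0: "m 0 = 0"
    and m_Suc: "\<And>k. m (Suc k) = \<beta> *\<^sub>R m k + (1 - \<beta>) *\<^sub>R G' (k mod n) (x k)"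
    and x_Suc: "\<And>k. x (Suc k) = x k - (\<eta> / real n) *\<^sub>R m (Suc k)"
begin

lemma norm_m_le: "norm (m k) \<le> G"
proof (induction k)
  case 0
  show ?case using G by (simp add: m_0)
next
  case (Suc k)
  have "norm (m (Suc k)) \<le> norm (\<beta> *\<^sub>R m k) + norm ((1 - \<beta>) *\<^sub>R G' (k mod n) (x k))"
    unfolding m_Suc by (rule norm_triangle_ineq)
  also have "\<dots> = \<beta> * norm (m k) + (1 - \<beta>) * norm (G' (k mod n) (x k))"
    using \<beta> by simp
  also have "\<dots> \<le> \<beta> * G + (1 - \<beta>) * G"
    using \<beta> n Suc bounded[of "k mod n" "x k"] by (intro add_mono mult_left_mono) auto
  finally show ?case by (simp add: algebra_simps)
qed

lemma x_add: "x (a + j) = x a - (\<eta> / real n) *\<^sub>R (\<Sum>k<j. m (Suc (a + k)))"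
  by (induction j) (simp_all add: x_Suc algebra_simps)

lemma norm_x_diff_le:
  assumes "j \<le> n"
  shows "norm (x (a + j) - x a) \<le> \<eta> * G"
proof -
  have "norm (\<Sum>k<j. m (Suc (a + k))) \<le> (\<Sum>k<j. G)"
    by (intro sum_norm_le norm_m_le)
  also have "\<dots> \<le> real n * G" using assms G by simp
  finally have "\<eta> / real n * norm (\<Sum>k<j. m (Suc (a + k))) \<le> \<eta> / real n * (real n * G)"
    using \<eta> by (intro mult_left_mono) auto
  then show ?thesis using n \<eta> by (simp add: x_add)
qed

lemma norm_F'_le: "norm (F' w) \<le> G"
proof -
  have "norm (\<Sum>i<n. G' i w) \<le> (\<Sum>i<n. G)"
    by (intro sum_norm_le bounded) simp
  then show ?thesis using n by (simp add: F' field_simps)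
qed

lemma F'_lipschitz: "norm (F' w - F' w') \<le> L * norm (w - w')"
proof -
  have "norm (\<Sum>i<n. G' i w - G' i w') \<le> (\<Sum>i<n. L * norm (w - w'))"
    by (intro sum_norm_le lipschitz) simp
  moreover have "F' w - F' w' = (1 / real n) *\<^sub>R (\<Sum>i<n. G' i w - G' i w')"
    by (simp add: F' sum_subtractf scaleR_diff_right)
  ultimately show ?thesis
    using n by (simp add: field_simps)
qed

text \<open>The average momentum of the epoch that starts after \<open>a\<close> steps.\<close>

definition M :: "nat \<Rightarrow> 'a" where
  "M a = (1 / real n) *\<^sub>R (\<Sum>k<n. m (Suc (a + k)))"

lemma norm_M_le: "norm (M a) \<le> G"
proof -
  have "norm (\<Sum>k<n. m (Suc (a + k))) \<le> (\<Sum>k<n. G)"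
    by (intro sum_norm_le norm_m_le)
  then show ?thesis using n by (simp add: M_def field_simps)
qed

lemma x_epoch: "x (a + n) = x a - \<eta> *\<^sub>R M a"
  by (simp add: x_add M_def)

text \<open>
  All points at which gradients are taken during the current and the previous epoch lie within
  \<open>\<eta> * G\<close> of the point where the current epoch starts.
\<close>

lemma norm_momentum_error_le:
  "norm (F' (x (a + n)) - M (a + n)) \<le> \<beta> ^ n * (2 * G) + (1 - \<beta> ^ n) * (L * (\<eta> * G))"
proof -
  define c where "c = x (a + n)"
  define b where "b = \<beta> ^ n"
  define e where "e = (\<Sum>k<n. m (Suc (a + n + k))) - b *\<^sub>R (\<Sum>k<n. m (Suc (a + k)))
            - (1 - b) *\<^sub>R (\<Sum>k<n. G' k c)"
  have b: "0 \<le> b" "b \<le> 1" using \<beta> by (auto simp: b_def intro: power_le_one)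
  have "norm (G' (k mod n) (x k) - G' (k mod n) c) \<le> L * (\<eta> * G)"
    if k: "a \<le> k" "k < a + 2 * n" for k
  proof -
    have "norm (x k - c) \<le> \<eta> * G"
    proof (cases "k \<le> a + n")
      case True
      then show ?thesis
        using norm_x_diff_le[of "a + n - k" k] k by (simp add: c_def norm_minus_commute)
    next
      case False
      then show ?thesis
        using norm_x_diff_le[of "k - (a + n)" "a + n"] k by (simp add: c_def)
    qed
    then have "L * norm (x k - c) \<le> L * (\<eta> * G)"
      using L by (intro mult_left_mono) auto
    with lipschitz[of "k mod n" "x k" c] n show ?thesis by simp
  qed
  then have E: "norm e \<le> (1 - b) * (real n * (L * (\<eta> * G)))"
    unfolding e_def b_def by (intro momentum_period_sum[where g = "\<lambda>k. G' (k mod n) (x k)"] m_Suc \<beta>)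
  have "(1 / real n) *\<^sub>R e = M (a + n) - b *\<^sub>R M a - (1 - b) *\<^sub>R F' c"
    unfolding e_def M_def F' scaleR_diff_right scaleR_left_commute[of "1 / real n"] by (rule refl)
  then have "F' c - M (a + n) = b *\<^sub>R (F' c - M a) - (1 / real n) *\<^sub>R e"
    by (simp only: scaleR_diff_right scaleR_diff_left scaleR_one) simp
  then have "norm (F' c - M (a + n)) \<le> norm (b *\<^sub>R (F' c - M a)) + norm ((1 / real n) *\<^sub>R e)"
    by (simp only: norm_triangle_ineq4)
  moreover have "norm (b *\<^sub>R (F' c - M a)) \<le> b * (2 * G)"
  proof -
    have "norm (F' c - M a) \<le> 2 * G"
      using norm_triangle_ineq4[of "F' c" "M a"] norm_F'_le[of c] norm_M_le[of a] by simp
    then show ?thesis using b by (simp add: mult_left_mono)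
  qed
  moreover have "norm ((1 / real n) *\<^sub>R e) \<le> (1 - b) * (L * (\<eta> * G))"
    using E n by (simp add: field_simps)
  ultimately show ?thesis by (simp add: b_def c_def)
qed

lemma epoch_descent:
  "(norm (F' (x a)))\<^sup>2 \<le> 2 / \<eta> * (F (x a) - F (x (a + n))) + (norm (F' (x a) - M a))\<^sup>2"
proof -
  let ?g = "F' (x a)"
  have "F (x (a + n)) \<le> F (x a) - \<eta> * (?g \<bullet> M a) + L / 2 * (\<eta> * norm (M a))\<^sup>2"
    using descent_lemma[OF GDERIV_F F'_lipschitz, of "x (a + n)" "x a"] \<eta> by (simp add: x_epoch)
  moreover have "L / 2 * (\<eta> * norm (M a))\<^sup>2 \<le> \<eta> / 2 * (norm (M a))\<^sup>2"
  proof -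
    have "L / 2 * (\<eta> * norm (M a))\<^sup>2 = (\<eta> * L) * (\<eta> / 2 * (norm (M a))\<^sup>2)"
      by (simp add: power2_eq_square)
    also have "\<dots> \<le> 1 * (\<eta> / 2 * (norm (M a))\<^sup>2)"
      using \<eta> by (intro mult_right_mono) auto
    finally show ?thesis by simp
  qed
  moreover have "\<eta> / 2 * ((norm (?g - M a))\<^sup>2 - (norm ?g)\<^sup>2)
      = \<eta> / 2 * (norm (M a))\<^sup>2 - \<eta> * (?g \<bullet> M a)"
    by (simp add: power2_norm_eq_inner inner_diff_left inner_diff_right inner_commute algebra_simps)
  ultimately have "F (x (a + n)) \<le> F (x a) + \<eta> / 2 * ((norm (?g - M a))\<^sup>2 - (norm ?g)\<^sup>2)"
    by linarith
  then show ?thesis using \<eta> by (simp add: field_simps)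
qed

lemma later_epoch:
  "(norm (F' (x (a + n))))\<^sup>2 \<le> 2 / \<eta> * (F (x (a + n)) - F (x (a + n + n)))
      + 4 * \<beta> ^ n * G\<^sup>2 + L\<^sup>2 * G\<^sup>2 * \<eta>\<^sup>2"
proof -
  let ?b = "\<beta> ^ n" and ?p = "2 * G" and ?q = "L * (\<eta> * G)"
  have b: "0 \<le> ?b" "?b \<le> 1" using \<beta> by (auto intro: power_le_one)
  have "(norm (F' (x (a + n)) - M (a + n)))\<^sup>2 \<le> (?b * ?p + (1 - ?b) * ?q)\<^sup>2"
    by (intro power_mono norm_momentum_error_le) simp
  \<comment> \<open>Convexity of the square, with its defect made explicit.\<close>
  also have "\<dots> = ?b * ?p\<^sup>2 + (1 - ?b) * ?q\<^sup>2 - ?b * (1 - ?b) * (?p - ?q)\<^sup>2"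
    by (simp add: power2_eq_square algebra_simps)
  also have "\<dots> \<le> ?b * ?p\<^sup>2 + 1 * ?q\<^sup>2 - 0"
    using b by (intro add_mono diff_mono mult_right_mono mult_nonneg_nonneg) auto
  finally show ?thesis
    using epoch_descent[of "a + n"] by (simp add: power_mult_distrib mult_ac)
qed

text \<open>
  The momentum starts at \<open>0\<close>, so in the first epoch its average need not be close to the gradient.
  It only matters that this epoch does not increase \<open>F\<close> by much.
\<close>

lemma first_epoch:
  "2 / \<eta> * F (x n) \<le> 2 / \<eta> * F (x 0) + (norm (F' (x 0)))\<^sup>2 / (\<eta> * L) + 2 * L * G\<^sup>2 * \<eta>"
proof -
  let ?g = "norm (F' (x 0))"
  have "F (x n) \<le> F (x 0) - \<eta> * (F' (x 0) \<bullet> M 0) + L / 2 * (\<eta> * norm (M 0))\<^sup>2"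
    using descent_lemma[OF GDERIV_F F'_lipschitz, of "x n" "x 0"] \<eta> x_epoch[of 0] by simp
  moreover have "- (F' (x 0) \<bullet> M 0) \<le> ?g * G"
  proof -
    have "\<bar>F' (x 0) \<bullet> M 0\<bar> \<le> ?g * norm (M 0)" by (rule Cauchy_Schwarz_ineq2)
    also have "\<dots> \<le> ?g * G" by (intro mult_left_mono norm_M_le) simp
    finally show ?thesis by simp
  qed
  then have "\<eta> * - (F' (x 0) \<bullet> M 0) \<le> \<eta> * (?g * G)"
    using \<eta> by (intro mult_left_mono) auto
  moreover have "L / 2 * (\<eta> * norm (M 0))\<^sup>2 \<le> L / 2 * (\<eta> * G)\<^sup>2"
    using L \<eta> norm_M_le[of 0] by (intro mult_left_mono power_mono) auto
  ultimately have "F (x n) \<le> F (x 0) + \<eta> * (?g * G) + L / 2 * (\<eta> * G)\<^sup>2"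
    by linarith
  then have "2 / \<eta> * F (x n) \<le> 2 / \<eta> * (F (x 0) + \<eta> * (?g * G) + L / 2 * (\<eta> * G)\<^sup>2)"
    using \<eta> by (intro mult_left_mono) auto
  also have "\<dots> = 2 / \<eta> * F (x 0) + 2 * ?g * G + L * G\<^sup>2 * \<eta>"
    using \<eta> by (simp add: power2_eq_square field_simps)
  finally have step: "2 / \<eta> * F (x n) \<le> 2 / \<eta> * F (x 0) + 2 * ?g * G + L * G\<^sup>2 * \<eta>" .
  \<comment> \<open>Young's inequality for \<open>2 * ?g * G\<close> with weight \<open>\<eta> * L\<close>.\<close>
  have "0 \<le> (?g - \<eta> * L * G)\<^sup>2 / (\<eta> * L)" using \<eta> L by simp
  also have "\<dots> = ?g\<^sup>2 / (\<eta> * L) - 2 * ?g * G + L * G\<^sup>2 * \<eta>"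
    using \<eta> L by (simp add: power2_eq_square field_simps)
  finally show ?thesis using step by simp
qed

lemma sum_norm_gradient_le:
  assumes "T \<ge> 1"
  shows "(\<Sum>t<T. (norm (F' (x (t * n))))\<^sup>2) \<le>
    2 / \<eta> * (F (x 0) - F_star) + (norm (F' (x 0)))\<^sup>2 / (\<eta> * L)
    + real T * (L\<^sup>2 * G\<^sup>2 * \<eta>\<^sup>2 + 4 * \<beta> ^ n * G\<^sup>2)
    + (norm (F' (x 0)))\<^sup>2 + 2 * L * G\<^sup>2 * \<eta>"
proof -
  \<comment> \<open>The gradient at \<open>x 0\<close> enters the bound as it is; the descent estimate covers the other \<open>N\<close> epochs.\<close>
  obtain N where T: "T = Suc N" using assms by (cases T) auto
  define c where "c = L\<^sup>2 * G\<^sup>2 * \<eta>\<^sup>2 + 4 * \<beta> ^ n * G\<^sup>2"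
  have c: "0 \<le> c" using \<beta> by (simp add: c_def)
  have "(\<Sum>t<N. (norm (F' (x (Suc t * n))))\<^sup>2)
      \<le> (\<Sum>t<N. 2 / \<eta> * (F (x (Suc t * n)) - F (x (Suc (Suc t) * n))) + c)"
    using later_epoch[of "_ * n"] by (intro sum_mono) (simp add: c_def algebra_simps)
  also have "\<dots> = 2 / \<eta> * (F (x n) - F (x (Suc N * n))) + real N * c"
    unfolding sum.distrib sum_distrib_left[symmetric]
    using sum_lessThan_telescope'[of "\<lambda>t. F (x (Suc t * n))" N] by simp
  also have "\<dots> \<le> 2 / \<eta> * (F (x n) - F_star) + real T * c"
    using \<eta> c F_star[of "x (Suc N * n)"] T
    by (intro add_mono mult_left_mono mult_right_mono diff_mono) auto
  finally have "(\<Sum>t<N. (norm (F' (x (Suc t * n))))\<^sup>2)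
      \<le> 2 / \<eta> * F (x n) - 2 / \<eta> * F_star + real T * c"
    by (simp only: right_diff_distrib)
  moreover have "(\<Sum>t<T. (norm (F' (x (t * n))))\<^sup>2)
      = (norm (F' (x 0)))\<^sup>2 + (\<Sum>t<N. (norm (F' (x (Suc t * n))))\<^sup>2)"
    unfolding T sum.lessThan_Suc_shift by simp
  ultimately show ?thesis
    using first_epoch by (simp only: right_diff_distrib flip: c_def)
qed

end

section \<open>The shuffling algorithm as a cyclic method\<close>

text \<open>All inner steps in succession, for a learning rate \<open>\<eta>\<close> that is the same in every epoch.\<close>

primrec smg_steps ::
  "(nat \<Rightarrow> 'a::euclidean_space \<Rightarrow> real) \<Rightarrow> nat \<Rightarrow> real \<Rightarrow> real \<Rightarrow> 'a \<Rightarrow> (nat \<Rightarrow> nat) \<Rightarrow> nat \<Rightarrow> 'a \<times> 'a"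
where
  "smg_steps f n \<beta> \<eta> w0 \<pi> 0 = (w0, 0)"
| "smg_steps f n \<beta> \<eta> w0 \<pi> (Suc k) =
    (let (w, m) = smg_steps f n \<beta> \<eta> w0 \<pi> k;
         m' = \<beta> *\<^sub>R m + (1 - \<beta>) *\<^sub>R grad (f (\<pi> (k mod n + 1))) w
     in (w - (\<eta> / real n) *\<^sub>R m', m'))"

lemma smg_inner_eq_steps:
  "i \<le> n \<Longrightarrow> smg_inner f n \<beta> \<eta> \<pi> (smg_steps f n \<beta> \<eta> w0 \<pi> (t * n)) i
     = smg_steps f n \<beta> \<eta> w0 \<pi> (t * n + i)"
  by (induction i) simp_all

lemma smg_epoch_eq_steps:
  "smg_epoch f n \<beta> (\<lambda>_. \<eta>) w0 \<pi> t = smg_steps f n \<beta> \<eta> w0 \<pi> (t * n)"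
  by (induction t) (simp_all add: smg_inner_eq_steps add.commute)

lemma GDERIV_average:
  fixes f :: "nat \<Rightarrow> 'a::euclidean_space \<Rightarrow> real"
  assumes "\<And>i. i \<in> A \<Longrightarrow> f i differentiable at w"
  shows "GDERIV (\<lambda>w. (\<Sum>i\<in>A. f i w) / c) w :> (1 / c) *\<^sub>R (\<Sum>i\<in>A. grad (f i) w)"
proof -
  have "((\<lambda>w. \<Sum>i\<in>A. f i w) has_derivative (\<lambda>v. \<Sum>i\<in>A. v \<bullet> grad (f i) w)) (at w)"
    using GDERIV_grad[OF assms] by (intro has_derivative_sum) (simp add: gderiv_def)
  then have "((\<lambda>w. (1 / c) * (\<Sum>i\<in>A. f i w)) has_derivative
      (\<lambda>v. (1 / c) * (\<Sum>i\<in>A. v \<bullet> grad (f i) w))) (at w)"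
    by (rule has_derivative_mult_right)
  then show ?thesis
    by (simp add: gderiv_def inner_sum_right)
qed

lemma smg_sum_norm_gradient_le:
  fixes f :: "nat \<Rightarrow> 'a::euclidean_space \<Rightarrow> real"
  assumes n: "n \<ge> 1" and T: "T \<ge> 1"
    and F: "\<And>w. F w = (\<Sum>i = 1..n. f i w) / real n"
    and diff: "\<And>i w. i \<in> {1..n} \<Longrightarrow> f i differentiable at w"
    and F_star: "\<And>w. F_star \<le> F w"
    and L: "L > 0"
    and smooth: "\<And>i w w'. i \<in> {1..n} \<Longrightarrow> norm (grad (f i) w - grad (f i) w') \<le> L * norm (w - w')"
    and G: "G > 0"
    and bounded_grad: "\<And>i w. i \<in> {1..n} \<Longrightarrow> norm (grad (f i) w) \<le> G"
    and \<beta>: "0 \<le> \<beta>" "\<beta> \<le> 1" and \<eta>: "\<eta> > 0" "\<eta> * L \<le> 1"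
    and \<pi>: "\<pi> permutes {1..n}"
  shows "(\<Sum>t<T. (norm (grad F (smg_iterate f n \<beta> (\<lambda>_. \<eta>) w0 \<pi> t)))\<^sup>2) \<le>
    2 / \<eta> * (F w0 - F_star) + (norm (grad F w0))\<^sup>2 / (\<eta> * L)
    + real T * (L\<^sup>2 * G\<^sup>2 * \<eta>\<^sup>2 + 4 * \<beta> ^ n * G\<^sup>2)
    + (norm (grad F w0))\<^sup>2 + 2 * L * G\<^sup>2 * \<eta>"
proof -
  define s where "s = smg_steps f n \<beta> \<eta> w0 \<pi>"
  have \<pi>_range: "\<pi> (i + 1) \<in> {1..n}" if "i < n" for i
    using permutes_in_image[OF \<pi>, of "i + 1"] that by simp
  have sum_\<pi>: "(\<Sum>i<n. grad (f (\<pi> (i + 1))) w) = (\<Sum>i\<in>{1..n}. grad (f i) w)" for w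
  proof -
    have "(\<Sum>i\<in>{1..n}. grad (f i) w) = (\<Sum>i\<in>{1..n}. grad (f (\<pi> i)) w)"
      by (rule sum.permute[OF \<pi>, unfolded o_def])
    also have "\<dots> = (\<Sum>i<n. grad (f (\<pi> (i + 1))) w)"
      by (simp add: sum.atLeast1_atMost_eq lessThan_atLeast0)
    finally show ?thesis by simp
  qed
  have GDERIV_F: "GDERIV F w :> (1 / real n) *\<^sub>R (\<Sum>i\<in>{1..n}. grad (f i) w)" for w
  proof -
    have "F = (\<lambda>w. (\<Sum>i = 1..n. f i w) / real n)" using F by auto
    then show ?thesis using GDERIV_average[of "{1..n}" f w "real n", OF diff] by simp
  qed
  have grad_F: "grad F w = (1 / real n) *\<^sub>R (\<Sum>i\<in>{1..n}. grad (f i) w)" for w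
    by (rule grad_eqI[OF GDERIV_F])
  interpret cyclic_momentum "\<lambda>i. grad (f (\<pi> (i + 1)))" F "grad F"
    "\<lambda>k. fst (s k)" "\<lambda>k. snd (s k)" n \<beta> \<eta> L G F_star
  proof
    show "grad F w = (1 / real n) *\<^sub>R (\<Sum>i<n. grad (f (\<pi> (i + 1))) w)" for w
      by (simp only: grad_F sum_\<pi>)
    show "GDERIV F w :> grad F w" for w
      using GDERIV_F by (simp only: grad_F)
    show "norm (grad (f (\<pi> (i + 1))) w - grad (f (\<pi> (i + 1))) w') \<le> L * norm (w - w')"
      if "i < n" for i w w' by (rule smooth[OF \<pi>_range[OF that]])
    show "norm (grad (f (\<pi> (i + 1))) w) \<le> G" if "i < n" for i w
      by (rule bounded_grad[OF \<pi>_range[OF that]])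
  qed (use n L G \<beta> \<eta> F_star in \<open>auto simp: s_def Let_def split: prod.splits\<close>)
  show ?thesis
    using sum_norm_gradient_le[OF T] by (simp add: smg_iterate_def smg_epoch_eq_steps s_def)
qed

text \<open>With a constant learning rate the output index is uniform.\<close>

lemma expectation_smg_output_le:
  fixes f :: "nat \<Rightarrow> 'a::euclidean_space \<Rightarrow> real" and h :: "'a \<Rightarrow> real"
  assumes T: "T \<ge> 1" and \<eta>: "\<eta> > 0"
    and fin: "finite (set_pmf P)"
    and le: "\<And>\<pi>. \<pi> \<in> set_pmf P \<Longrightarrow>
      (\<Sum>t<T. h (smg_iterate f n \<beta> (\<lambda>_. \<eta>) w0 \<pi> t)) \<le> real T * B"
  shows "measure_pmf.expectation (smg_output f n \<beta> (\<lambda>_. \<eta>) T w0 P) h \<le> B"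
proof -
  let ?I = "smg_index_pmf T (\<lambda>_. \<eta>)"
  let ?h = "\<lambda>\<pi> t. h (smg_iterate f n \<beta> (\<lambda>_. \<eta>) w0 \<pi> (t - 1))"
  have I: "pmf ?I t = (if t \<in> {1..T} then 1 / real T else 0)" for t
    using pmf_smg_index_pmf[of T "\<lambda>_. \<eta>" t] T \<eta> by simp
  have "measure_pmf.expectation (smg_output f n \<beta> (\<lambda>_. \<eta>) T w0 P) h
      = measure_pmf.expectation (pair_pmf P ?I) (\<lambda>(\<pi>, t). ?h \<pi> t)"
    by (simp add: smg_output_def case_prod_unfold)
  also have "\<dots> = (\<Sum>z\<in>set_pmf P \<times> {1..T}. (case z of (\<pi>, t) \<Rightarrow> ?h \<pi> t) * pmf (pair_pmf P ?I) z)"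
    by (rule integral_measure_pmf_real)
       (use fin I in \<open>auto simp: set_pmf_iff split: if_splits\<close>)
  also have "\<dots> = (\<Sum>(\<pi>, t)\<in>set_pmf P \<times> {1..T}. pmf P \<pi> * (?h \<pi> t / real T))"
    by (intro sum.cong) (auto simp: pmf_pair I)
  also have "\<dots> = (\<Sum>\<pi>\<in>set_pmf P. pmf P \<pi> * ((\<Sum>t\<in>{1..T}. ?h \<pi> t) / real T))"
    by (simp only: sum.cartesian_product[symmetric] sum_distrib_left sum_divide_distrib)
  also have "\<dots> \<le> (\<Sum>\<pi>\<in>set_pmf P. pmf P \<pi> * B)"
  proof (intro sum_mono mult_left_mono)
    fix \<pi> assume "\<pi> \<in> set_pmf P"
    then have "(\<Sum>t\<in>{1..T}. ?h \<pi> t) \<le> real T * B"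
      using le by (simp add: sum.atLeast1_atMost_eq lessThan_atLeast0)
    then show "(\<Sum>t\<in>{1..T}. ?h \<pi> t) / real T \<le> B"
      using T by (simp add: field_simps)
  qed simp
  also have "\<dots> = B"
    using sum_pmf_eq_1[OF fin order_refl] by (simp flip: sum_distrib_right)
  finally show ?thesis .
qed

section \<open>The convergence rate\<close>

theorem corollary7:
  fixes f :: "nat \<Rightarrow> real ^ 'd \<Rightarrow> real" and F :: "real ^ 'd \<Rightarrow> real" and n :: nat
    and L G \<nu> R \<gamma> F_star D0 :: real
    and w0 :: "real ^ 'd"
    and \<beta> :: "nat \<Rightarrow> real" and \<eta> :: "nat \<Rightarrow> nat \<Rightarrow> real"
    and P :: "nat \<Rightarrow> (nat \<Rightarrow> nat) pmf"
    and E :: "nat \<Rightarrow> real"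
  assumes n: "n \<ge> 1"
    and F: "\<And>w. F w = (\<Sum>i = 1..n. f i w) / real n"
    and diff: "\<And>i w. i \<in> {1..n} \<Longrightarrow> f i differentiable at w"
    and bdd: "bdd_below (range F)"
    and F_star: "F_star = (INF w. F w)"
    and L: "L > 0"
    and smooth: "\<And>i w w'. i \<in> {1..n} \<Longrightarrow> norm (grad (f i) w - grad (f i) w') \<le> L * norm (w - w')"
    and G: "G > 0"
    and bounded_grad: "\<And>i w. i \<in> {1..n} \<Longrightarrow> norm (grad (f i) w) \<le> G"
    and nu: "\<nu> \<ge> 0" and R: "R \<ge> 1" and gamma: "\<gamma> > 0"
    and beta: "\<And>T. \<beta> T = (\<nu> / real T powr (2/3)) powr (1 / real n)"
    and eta: "\<And>T t. \<eta> T t = \<gamma> / real T powr (1/3)"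
    and perm: "\<And>T. set_pmf (P T) \<subseteq> {\<pi>. \<pi> permutes {1..n}}"
    and E: "\<And>T. E T = measure_pmf.expectation (smg_output f n (\<beta> T) (\<eta> T) T w0 (P T))
                        (\<lambda>w. (norm (grad F w))\<^sup>2)"
    and D0: "D0 = 2 * R / \<gamma> * (F w0 - F_star) + R / (\<gamma> * L) * (norm (grad F w0))\<^sup>2
                  + L\<^sup>2 * G\<^sup>2 * \<gamma>\<^sup>2 + 4 * \<nu> * G\<^sup>2 * R"
  shows "(\<forall>T\<ge>1. \<beta> T \<le> ((R - 1) / R) powr (1 / real n) \<and> \<gamma> / real T powr (1/3) \<le> 1 / L \<longrightarrow>
            E T \<le> D0 / real T powr (2/3) + R * (norm (grad F w0))\<^sup>2 / real T
                    + 2 * L * G\<^sup>2 * R * \<gamma> / real T powr (4/3))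
       \<and> ((\<forall>\<^sub>F T in sequentially.
             \<beta> T \<le> ((R - 1) / R) powr (1 / real n) \<and> \<gamma> / real T powr (1/3) \<le> 1 / L) \<longrightarrow>
            E \<in> O(\<lambda>T. real T powr (- 2/3)))"
proof -
  let ?adm = "\<lambda>T. \<beta> T \<le> ((R - 1) / R) powr (1 / real n) \<and> \<gamma> / real T powr (1/3) \<le> 1 / L"
  let ?rhs = "\<lambda>T. D0 / real T powr (2/3) + R * (norm (grad F w0))\<^sup>2 / real T
                    + 2 * L * G\<^sup>2 * R * \<gamma> / real T powr (4/3)"
  have F_star_le: "F_star \<le> F w" for w
    unfolding F_star by (rule cINF_lower[OF bdd]) simp
  have bound: "E T \<le> ?rhs T" if T: "T \<ge> 1" and adm: "?adm T" for T
  proof -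
    define p where "p = real T powr (1/3)"
    define e where "e = \<gamma> / p"
    let ?N = "(norm (grad F w0))\<^sup>2"
    let ?\<Delta> = "F w0 - F_star"
    have p: "p > 0" using T by (simp add: p_def)
    have p2: "real T powr (2/3) = p\<^sup>2" and p3: "real T = p ^ 3" and p4: "real T powr (4/3) = p ^ 4"
      using T by (simp_all add: p_def powr_power)
    have e: "e > 0" "e * L \<le> 1"
      using gamma p adm L by (auto simp: e_def p_def field_simps)
    have \<beta>0: "0 \<le> \<beta> T" by (simp add: beta)
    have \<beta>1: "\<beta> T \<le> 1"
    proof -
      have "((R - 1) / R) powr (1 / real n) \<le> 1 powr (1 / real n)"
        using R by (intro powr_mono2) auto
      then show ?thesis using adm by simp
    qed
    have b: "\<beta> T ^ n = \<nu> / p\<^sup>2"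
    proof -
      have "((\<nu> / p\<^sup>2) powr (1 / real n)) ^ n = \<nu> / p\<^sup>2"
        using powr_power[of "\<nu> / p\<^sup>2" "1 / real n" n] n nu p by (cases "\<nu> = 0") auto
      then show ?thesis by (simp only: beta p2)
    qed
    have "E T = measure_pmf.expectation (smg_output f n (\<beta> T) (\<lambda>_. e) T w0 (P T))
                  (\<lambda>w. (norm (grad F w))\<^sup>2)"
    proof -
      have "\<eta> T = (\<lambda>_. e)" by (auto simp: eta e_def p_def)
      then show ?thesis by (simp add: E)
    qed
    also have "\<dots> \<le> (2 / e * ?\<Delta> + ?N / (e * L) + real T * (L\<^sup>2 * G\<^sup>2 * e\<^sup>2 + 4 * \<beta> T ^ n * G\<^sup>2)
        + ?N + 2 * L * G\<^sup>2 * e) / real T"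
    proof (rule expectation_smg_output_le[OF T e(1)])
      show "finite (set_pmf (P T))"
        by (rule finite_subset[OF perm]) (simp add: finite_permutations)
    next
      fix \<pi> assume "\<pi> \<in> set_pmf (P T)"
      then have "\<pi> permutes {1..n}" using perm by blast
      from smg_sum_norm_gradient_le[OF n T F diff F_star_le L smooth G bounded_grad \<beta>0 \<beta>1 e this]
      show "(\<Sum>t<T. (norm (grad F (smg_iterate f n (\<beta> T) (\<lambda>_. e) w0 \<pi> t)))\<^sup>2)
          \<le> real T * ((2 / e * ?\<Delta> + ?N / (e * L) + real T * (L\<^sup>2 * G\<^sup>2 * e\<^sup>2 + 4 * \<beta> T ^ n * G\<^sup>2)
        + ?N + 2 * L * G\<^sup>2 * e) / real T)"
        using T by simp
    qed
    also have "\<dots> = (2 / \<gamma> * ?\<Delta> + 1 / (\<gamma> * L) * ?N + L\<^sup>2 * G\<^sup>2 * \<gamma>\<^sup>2 + 4 * \<nu> * G\<^sup>2) / p\<^sup>2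
        + ?N / p ^ 3 + 2 * L * G\<^sup>2 * \<gamma> / p ^ 4"
      unfolding b e_def p3 using p gamma L
      by (simp add: field_simps power2_eq_square power3_eq_cube power4_eq_xxxx)
    also have "\<dots> \<le> ?rhs T"
    proof -
      \<comment> \<open>Every term but \<open>L\<^sup>2 * G\<^sup>2 * \<gamma>\<^sup>2\<close> is enlarged by the factor \<open>R \<ge> 1\<close>.\<close>
      have R_mult: "z \<le> R * z" if "z \<ge> 0" for z
        using mult_right_mono[OF R that] by simp
      have "2 / \<gamma> * ?\<Delta> + 1 / (\<gamma> * L) * ?N + L\<^sup>2 * G\<^sup>2 * \<gamma>\<^sup>2 + 4 * \<nu> * G\<^sup>2 \<le> D0"
        using R_mult[of "2 / \<gamma> * ?\<Delta>"] R_mult[of "1 / (\<gamma> * L) * ?N"] R_mult[of "4 * \<nu> * G\<^sup>2"]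
          gamma L nu F_star_le[of w0]
        by (simp add: D0 mult_ac)
      moreover have "?N \<le> R * ?N" by (rule R_mult) simp
      moreover have "2 * L * G\<^sup>2 * \<gamma> \<le> 2 * L * G\<^sup>2 * R * \<gamma>"
        using R_mult[of "2 * L * G\<^sup>2 * \<gamma>"] L gamma by (simp add: mult_ac)
      ultimately show ?thesis
        unfolding p2 p4 using p by (simp only: p3) (intro add_mono divide_right_mono; simp)
    qed
    finally show ?thesis .
  qed
  have "E \<in> O(\<lambda>T. real T powr (- 2/3))" if ev: "\<forall>\<^sub>F T in sequentially. ?adm T"
  proof -
    have "E \<in> O(?rhs)"
    proof (rule landau_o.big_mono)
      show "\<forall>\<^sub>F T in sequentially. norm (E T) \<le> norm (?rhs T)"
        using ev eventually_ge_at_top[of 1]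
      proof eventually_elim
        case (elim T)
        have "0 \<le> E T" unfolding E by (rule Bochner_Integration.integral_nonneg) simp
        with bound[of T] elim show ?case by simp
      qed
    qed
    also have "?rhs \<in> O(\<lambda>T. real T powr (- 2/3))"
    proof (intro sum_in_bigo)
      have powr_bound: "(\<lambda>T. c / real T powr q) \<in> O(\<lambda>T. real T powr (- 2/3))"
        if "q \<ge> 2/3" for c q :: real
      proof -
        have "\<forall>\<^sub>F T in sequentially. norm (c / real T powr q) \<le> \<bar>c\<bar> * norm (real T powr (- 2/3))"
          using eventually_ge_at_top[of 1]
        proof eventually_elim
          case (elim T)
          then have "\<bar>c\<bar> * real T powr - q \<le> \<bar>c\<bar> * real T powr (- 2/3)"
            using that by (intro mult_left_mono powr_mono) auto
          then show ?case by (simp add: powr_minus_divide)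
        qed
        then show ?thesis by (rule bigoI)
      qed
      show "(\<lambda>T. D0 / real T powr (2/3)) \<in> O(\<lambda>T. real T powr (- 2/3))"
        by (rule powr_bound) simp
      show "(\<lambda>T. R * (norm (grad F w0))\<^sup>2 / real T) \<in> O(\<lambda>T. real T powr (- 2/3))"
        using powr_bound[of 1] by simp
      show "(\<lambda>T. 2 * L * G\<^sup>2 * R * \<gamma> / real T powr (4/3)) \<in> O(\<lambda>T. real T powr (- 2/3))"
        by (rule powr_bound) simp
    qed
    finally show ?thesis .
  qed
  with bound show ?thesis by blast
qed

end
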